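(* Let $A$ be a nontrivial separating separable (closed linear) subspace of $C(K)$, where $K$ is a compact Hausdorff space. Then the set of all peak functions in $A$ is a dense $G_\delta$-subset of $A$. In particular, $\rho A$ is a norming subset for $A$ and $\partial A=\overline{\rho A}$; that is, the closure of $\rho A$ is the smallest closed norming subset for $A$.
   Context: $C(K)$ is the complex Banach space of continuous complex-valued functions on $K$ with the sup norm. "Subspace" means closed linear subspace; nontrivial means $A\ne\{0\}$; separable refers to the norm topology. $A$ is separating if for all distinct $t,s\in K$ and all complex $\alpha,\beta$ of modulus $1$, $\alpha\delta_t\neq\beta\delta_s$ as functionals on $A$, where $\delta_t(f)=f(t)$. A nonzero $f\in A$ is a peak function if there is exactly one $x\in K$ with $|f(x)|=\|f\|$. A nonzero $f\in A$ is a strong peak function if there is exactly one $x\in K$ with $|f(x)|=\|f\|$ and for every neighborhood $V$ of $x$ there is $\delta>0$ with $|f(y)|\le\|f\|-\delta$ for all $y\in K\setminus V$; then $x$ is a strong peak point for $A$. $\rho A$ is the set of strong peak points for $A$ (for compact $K$, peak functions and strong peak functions coincide). $F\subset K$ is a norming subset for $A$ if $\|f\|=\sup_{x\in F}|f(x)|$ for every $f\in A$. $\partial A$ (the Shilov boundary) denotes the smallest closed norming subset for $A$, when it exists. *)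

theory Defs
  imports "HOL-Analysis.Analysis"
begin

text \<open>
  The underlying space is a whole type. When that type is compact, every continuous function on
  it is bounded, so \<^typ>\<open>'a \<Rightarrow>\<^sub>C complex\<close> is all of C(K), and its library norm is the sup norm.
  The library makes this type only a real vector space; complex multiples are added here.
\<close>

definition cscale ::
    "complex \<Rightarrow> ('a::topological_space \<Rightarrow>\<^sub>C complex) \<Rightarrow> ('a \<Rightarrow>\<^sub>C complex)" where
  "cscale c f = Bcontfun (\<lambda>x. c * f x)"

lemma apply_cscale [simp]: "apply_bcontfun (cscale c f) x = c * apply_bcontfun f x"
proof -
  have "bounded ((\<lambda>z. c * z) ` range f)"
    by (rule bounded_linear_image) (auto intro: bounded_linear_mult_right)
  then have "(\<lambda>x. c * f x) \<in> bcontfun"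
    by (auto simp: bcontfun_def image_image intro: continuous_intros)
  then show ?thesis
    by (simp add: cscale_def Bcontfun_inverse)
qed

lemma vector_space_cscale: "vector_space cscale"
  by unfold_locales
    (auto intro!: bcontfun_eqI simp: plus_bcontfun.rep_eq algebra_simps)

definition closed_csubspace :: "('a::topological_space \<Rightarrow>\<^sub>C complex) set \<Rightarrow> bool" where
  "closed_csubspace A \<longleftrightarrow> module.subspace cscale A \<and> closed A"

definition separating :: "('a::topological_space \<Rightarrow>\<^sub>C complex) set \<Rightarrow> bool" where
  "separating A \<longleftrightarrow>
     (\<forall>t s \<alpha> \<beta>. t \<noteq> s \<longrightarrow> cmod \<alpha> = 1 \<longrightarrow> cmod \<beta> = 1 \<longrightarrow> (\<exists>f\<in>A. \<alpha> * apply_bcontfun f t \<noteq> \<beta> * apply_bcontfun f s))"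

definition peak_functions ::
    "('a::topological_space \<Rightarrow>\<^sub>C complex) set \<Rightarrow> ('a \<Rightarrow>\<^sub>C complex) set" where
  "peak_functions A = {f \<in> A. f \<noteq> 0 \<and> (\<exists>!x. cmod (apply_bcontfun f x) = norm f)}"

definition strong_peak_at :: "('a::topological_space \<Rightarrow>\<^sub>C complex) \<Rightarrow> 'a \<Rightarrow> bool" where
  "strong_peak_at f x \<longleftrightarrow> f \<noteq> 0 \<and> cmod (f x) = norm f \<and> (\<forall>y. cmod (f y) = norm f \<longrightarrow> y = x) \<and>
     (\<forall>V. x \<in> interior V \<longrightarrow> (\<exists>\<delta>>0. \<forall>y. y \<notin> V \<longrightarrow> cmod (f y) \<le> norm f - \<delta>))"

definition strong_peak_points :: "('a::topological_space \<Rightarrow>\<^sub>C complex) set \<Rightarrow> 'a set" where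
  "strong_peak_points A = {x. \<exists>f\<in>A. strong_peak_at f x}"

text \<open>
  The supremum over the empty set is an unspecified real number, but the empty set is still not
  norming for a nontrivial subspace, because the norm is not constant on it.
\<close>

definition norming :: "('a::topological_space \<Rightarrow>\<^sub>C complex) set \<Rightarrow> 'a set \<Rightarrow> bool" where
  "norming A F \<longleftrightarrow> (\<forall>f\<in>A. norm f = (SUP x\<in>F. cmod (apply_bcontfun f x)))"

definition smallest_closed_norming ::
    "('a::topological_space \<Rightarrow>\<^sub>C complex) set \<Rightarrow> 'a set \<Rightarrow> bool" where
  "smallest_closed_norming A F \<longleftrightarrow>
     closed F \<and> norming A F \<and> (\<forall>G. closed G \<and> norming A G \<longrightarrow> F \<subseteq> G)"

text \<open>Meaningful only if a smallest closed norming subset exists.\<close>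

definition shilov_boundary :: "('a::topological_space \<Rightarrow>\<^sub>C complex) set \<Rightarrow> 'a set" where
  "shilov_boundary A = (THE F. smallest_closed_norming A F)"

end

theory Submission
  imports Defs
begin

text \<open>
  Call \<open>x\<close> a maximizer of \<open>f\<close> if \<open>|f(x)| = \<parallel>f\<parallel>\<close>. At a maximizer \<open>x\<close>, the number
  \<open>Re (cnj (f x) * h x)\<close> is half the derivative at \<open>t = 0\<close> of \<open>|f(x) + t h(x)|\<^sup>2\<close>.
  Along a line \<open>f + t h\<close> these derivatives, taken at arbitrary maximizers, increase with \<open>t\<close>,
  because each \<open>|f(x) + t h(x)|\<^sup>2\<close> is convex in \<open>t\<close>; as they are bounded on bounded intervals,
  for any \<open>e > 0\<close> only finitely many \<open>t\<close> in such an interval admit two maximizers whose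
  derivatives differ by at least \<open>e\<close>. By compactness the functions admitting such a pair form a
  closed set, which is therefore nowhere dense in \<open>A\<close>. A nonzero \<open>f\<close> outside these sets, with
  \<open>h\<close> running over a countable dense subset of \<open>A\<close> and \<open>e = 1/(n+1)\<close>, satisfies
  \<open>cnj (f x) * h x = cnj (f y) * h y\<close> for all \<open>h\<close> in \<open>A\<close> and all maximizers \<open>x\<close>, \<open>y\<close>, and then
  \<open>x = y\<close> because \<open>A\<close> is separating. Baire's theorem finishes the proof.
\<close>

section \<open>Bounded continuous functions\<close>

text \<open>The library's \<open>complete_space\<close> instance requires the domain to be a metric space.\<close>

lemma complete_bcontfun:
  "complete (UNIV :: ('a::topological_space \<Rightarrow>\<^sub>C 'b::complete_space) set)"
  unfolding complete_def
proof (intro allI impI)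
  fix f :: "nat \<Rightarrow> 'a \<Rightarrow>\<^sub>C 'b"
  assume "(\<forall>n. f n \<in> UNIV) \<and> Cauchy f"
  then have "Cauchy f"
    by simp
  then obtain g where "uniform_limit UNIV f g sequentially"
    using uniformly_convergent_eq_cauchy[of "\<lambda>_. True" f]
    unfolding Cauchy_def uniform_limit_sequentially_iff
    by (metis dist_fun_lt_imp_dist_val_lt)
  from uniform_limit_bcontfunE[OF this sequentially_bot]
  show "\<exists>l\<in>UNIV. f \<longlonglongrightarrow> l"
    by (metis UNIV_I)
qed

lemma completely_metrizable_space_closed_bcontfun:
  fixes A :: "('a::topological_space \<Rightarrow>\<^sub>C 'b::complete_space) set"
  assumes "closed A"
  shows "completely_metrizable_space (top_of_set A)"
proof -
  have "completely_metrizable_space (euclidean :: ('a \<Rightarrow>\<^sub>C 'b) topology)"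
    using Met_TC.completely_metrizable_space_mtopology complete_bcontfun by auto
  then show ?thesis
    by (rule completely_metrizable_space_closedin) (use assms in simp)
qed

text \<open>Changing the function costs at most the sup distance, uniformly in the point; changing
  the point costs little because the fixed function \<open>p w\<close> is continuous.\<close>

lemma continuous_on_apply_bcontfun_pair:
  fixes p :: "'c::topological_space \<Rightarrow> 'a::topological_space \<Rightarrow>\<^sub>C 'b::metric_space"
  assumes "continuous_on S p" "continuous_on S q"
  shows "continuous_on S (\<lambda>z. apply_bcontfun (p z) (q z))"
  unfolding continuous_on_def
proof
  fix w assume w: "w \<in> S"
  have "((\<lambda>z. dist (p z) (p w)) \<longlongrightarrow> 0) (at w within S)"
    using assms(1) w unfolding continuous_on_def tendsto_dist_iff[symmetric] by blast
  moreover have "continuous_on S (\<lambda>z. apply_bcontfun (p w) (q z))"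
    using continuous_on_compose2[OF continuous_on_apply_bcontfun assms(2), of UNIV] by auto
  then have "((\<lambda>z. dist (apply_bcontfun (p w) (q z)) (apply_bcontfun (p w) (q w))) \<longlongrightarrow> 0)
      (at w within S)"
    using w unfolding continuous_on_def tendsto_dist_iff[symmetric] by blast
  ultimately have lim: "((\<lambda>z. dist (p z) (p w) +
      dist (apply_bcontfun (p w) (q z)) (apply_bcontfun (p w) (q w))) \<longlongrightarrow> 0) (at w within S)"
    by (rule tendsto_add_zero)
  have bnd: "dist (apply_bcontfun (p z) (q z)) (apply_bcontfun (p w) (q w))
      \<le> dist (p z) (p w) + dist (apply_bcontfun (p w) (q z)) (apply_bcontfun (p w) (q w))" for z
    using dist_triangle[of "apply_bcontfun (p z) (q z)" "apply_bcontfun (p w) (q w)"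
        "apply_bcontfun (p w) (q z)"] dist_bounded[of "p z" "q z" "p w"] by linarith
  have "((\<lambda>z. dist (apply_bcontfun (p z) (q z)) (apply_bcontfun (p w) (q w))) \<longlongrightarrow> 0)
      (at w within S)"
    by (rule tendsto_sandwich[OF _ _ tendsto_const lim]) (auto simp: bnd)
  then show "((\<lambda>z. apply_bcontfun (p z) (q z)) \<longlongrightarrow> apply_bcontfun (p w) (q w)) (at w within S)"
    by (simp only: tendsto_dist_iff[symmetric])
qed

lemma norm_bcontfun_attained:
  fixes f :: "'a::topological_space \<Rightarrow>\<^sub>C 'b::real_normed_vector"
  assumes "compact (UNIV :: 'a set)"
  obtains x where "norm (apply_bcontfun f x) = norm f"
proof -
  obtain x where "\<forall>y. norm (apply_bcontfun f y) \<le> norm (apply_bcontfun f x)"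
    using continuous_attains_sup[OF assms, of "\<lambda>x. norm (apply_bcontfun f x)"]
    by (auto intro: continuous_intros)
  then have "norm f \<le> norm (apply_bcontfun f x)"
    by (intro norm_bound) auto
  then show thesis
    using that norm_bounded[of f x] by force
qed

text \<open>This removes the existential quantifiers over maximizers in \<open>two_slopes\<close>
  without losing closedness.\<close>

lemma closed_projection_compact:
  fixes C :: "('a::topological_space \<times> 'b::topological_space) set"
  assumes "compact (UNIV :: 'b set)" "closed C"
  shows "closed (fst ` C)"
proof -
  have "compact_space (euclidean :: 'b topology)"
    using assms(1) by (simp add: compact_space_def)
  then have "closed_map (prod_topology euclidean (euclidean :: 'b topology))
      (euclidean :: 'a topology) fst"
    by (rule closed_map_fst)
  then show ?thesis
    using assms(2) by (simp add: closed_map_def)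
qed

lemma dense_in_iff:
  fixes A :: "'a::metric_space set"
  assumes "T \<subseteq> A"
  shows "(top_of_set A) closure_of T = A \<longleftrightarrow> (\<forall>f\<in>A. \<forall>e>0. \<exists>g\<in>T. dist g f < e)"
proof -
  have "(top_of_set A) closure_of T = A \<inter> closure T"
    using assms by (simp add: closure_of_subtopology inf_absorb2)
  then show ?thesis
    by (simp add: inf.absorb_iff1[symmetric] subset_iff closure_approachable Ball_def)
qed

section \<open>Complex subspaces\<close>

lemma
  assumes "closed_csubspace A"
  shows csubspace_0: "0 \<in> A"
    and csubspace_add: "f \<in> A \<Longrightarrow> g \<in> A \<Longrightarrow> f + g \<in> A"
    and csubspace_cscale: "f \<in> A \<Longrightarrow> cscale c f \<in> A"
proof -
  interpret vector_space cscale
    by (rule vector_space_cscale)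
  have "subspace A"
    using assms by (simp add: closed_csubspace_def)
  then show "0 \<in> A" "f \<in> A \<Longrightarrow> g \<in> A \<Longrightarrow> f + g \<in> A" "f \<in> A \<Longrightarrow> cscale c f \<in> A"
    by (auto intro: subspace_0 subspace_add subspace_scale)
qed

lemma csubspace_scaleR:
  assumes "closed_csubspace A" "f \<in> A"
  shows "t *\<^sub>R f \<in> A"
proof -
  have "t *\<^sub>R f = cscale (of_real t) f"
    by (rule bcontfun_eqI) (simp add: scaleR_conv_of_real)
  then show ?thesis
    using csubspace_cscale[OF assms] by simp
qed

section \<open>Functions with two distinguishable maximizers\<close>

text \<open>The fixed gap \<open>e\<close> and the weak inequality make this a closed condition. For
  positive \<open>e\<close> the gap forces \<open>x\<close> and \<open>y\<close> to be
  distinct.\<close>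

definition two_slopes ::
    "('a::topological_space \<Rightarrow>\<^sub>C complex) \<Rightarrow> real \<Rightarrow> ('a \<Rightarrow>\<^sub>C complex) set" where
  "two_slopes h e = {f. \<exists>x y. cmod (apply_bcontfun f x) = norm f \<and> cmod (apply_bcontfun f y) = norm f \<and>
     Re (cnj (apply_bcontfun f y) * apply_bcontfun h y) + e
       \<le> Re (cnj (apply_bcontfun f x) * apply_bcontfun h x)}"

lemma closed_two_slopes:
  fixes h :: "'a::topological_space \<Rightarrow>\<^sub>C complex"
  assumes "compact (UNIV :: 'a set)"
  shows "closed (two_slopes h e)"
proof -
  let ?C = "{p :: ('a \<Rightarrow>\<^sub>C complex) \<times> 'a \<times> 'a.
     cmod (apply_bcontfun (fst p) (fst (snd p))) = norm (fst p) \<and>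
     cmod (apply_bcontfun (fst p) (snd (snd p))) = norm (fst p) \<and>
     Re (cnj (apply_bcontfun (fst p) (snd (snd p))) * apply_bcontfun h (snd (snd p))) + e
       \<le> Re (cnj (apply_bcontfun (fst p) (fst (snd p))) * apply_bcontfun h (fst (snd p)))}"
  have "closed ?C"
    by (intro closed_Collect_conj closed_Collect_eq closed_Collect_le continuous_intros
        continuous_on_apply_bcontfun_pair)
  moreover have "compact (UNIV :: ('a \<times> 'a) set)"
    using compact_Times[OF assms assms] by simp
  ultimately have "closed (fst ` ?C)"
    by (intro closed_projection_compact)
  moreover have "fst ` ?C = two_slopes h e"
    by (force simp: two_slopes_def image_iff)
  ultimately show ?thesis
    by simp
qed

text \<open>For each point, the squared modulus is a quadratic in the parameter with nonnegative
  leading coefficient, so it lies above its tangents. Take the tangent at \<open>s\<close> for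
  \<open>u\<close>, evaluated at \<open>t\<close>, and the tangent at \<open>t\<close> for
  \<open>v\<close>, evaluated at \<open>s\<close>. Adding the two inequalities and using the
  maximality of \<open>u\<close> and \<open>v\<close> cancels the squared moduli.\<close>

lemma slope_mono:
  fixes f h :: "'a::topological_space \<Rightarrow>\<^sub>C complex"
  assumes "s < t"
    and u: "cmod (apply_bcontfun (f + s *\<^sub>R h) u) = norm (f + s *\<^sub>R h)"
    and v: "cmod (apply_bcontfun (f + t *\<^sub>R h) v) = norm (f + t *\<^sub>R h)"
  shows "Re (cnj (apply_bcontfun (f + s *\<^sub>R h) u) * apply_bcontfun h u)
    \<le> Re (cnj (apply_bcontfun (f + t *\<^sub>R h) v) * apply_bcontfun h v)"
proof -
  define p where "p r z = (cmod (apply_bcontfun (f + r *\<^sub>R h) z))\<^sup>2" for r z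
  define D where "D r z = Re (cnj (apply_bcontfun (f + r *\<^sub>R h) z) * apply_bcontfun h z)" for r z
  have tangent: "p r z + 2 * (r' - r) * D r z \<le> p r' z" for r r' z
  proof -
    have "p r' z = p r z + 2 * (r' - r) * D r z + (r' - r)\<^sup>2 * (cmod (apply_bcontfun h z))\<^sup>2"
      unfolding p_def D_def cmod_power2
      by (simp add: algebra_simps power2_eq_square)
    then show ?thesis
      by simp
  qed
  have "p s v \<le> p s u" "p t u \<le> p t v"
    unfolding p_def u v by (intro power_mono norm_bounded norm_ge_zero)+
  with tangent[of s u t] tangent[of t v s]
  have "2 * (t - s) * D s u \<le> 2 * (t - s) * D t v"
    by (simp add: algebra_simps)
  then show ?thesis
    using \<open>s < t\<close> by (simp add: D_def)
qed

lemma line_leaves_two_slopes: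
  fixes f h :: "'a::topological_space \<Rightarrow>\<^sub>C complex"
  assumes "0 < e" "0 < d"
  obtains t where "0 < t" "t < d" "f + t *\<^sub>R h \<notin> two_slopes h e"
proof (rule ccontr)
  assume "\<not> thesis"
  with that have stay: "f + t *\<^sub>R h \<in> two_slopes h e" if "0 < t" "t < d" for t
    using that by blast
  define D where "D r z = Re (cnj (apply_bcontfun (f + r *\<^sub>R h) z) * apply_bcontfun h z)" for r z
  define M where "M r z \<longleftrightarrow> cmod (apply_bcontfun (f + r *\<^sub>R h) z) = norm (f + r *\<^sub>R h)" for r z
  have "\<forall>t. \<exists>x y. 0 < t \<and> t < d \<longrightarrow> M t x \<and> M t y \<and> D t y + e \<le> D t x"
    using stay unfolding two_slopes_def D_def M_def by blast
  then obtain X Y where XY: "\<And>t. 0 < t \<Longrightarrow> t < d \<Longrightarrow>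
      M t (X t) \<and> M t (Y t) \<and> D t (Y t) + e \<le> D t (X t)"
    by metis
  \<comment> \<open>The sequence starts at \<open>d / 2\<close> and increases strictly towards
    \<open>d\<close>, staying inside the interval.\<close>
  define \<tau> where "\<tau> n = d * (1 - 1 / (real n + 2))" for n :: nat
  have \<tau>: "0 < \<tau> n" "\<tau> n < d" "\<tau> n < \<tau> (Suc n)" for n
    using \<open>0 < d\<close> by (simp_all add: \<tau>_def field_simps add_pos_nonneg)
  have lower: "D (\<tau> 0) (X (\<tau> 0)) + real n * e \<le> D (\<tau> n) (X (\<tau> n))" for n
  proof (induction n)
    case (Suc n)
    have "D (\<tau> n) (X (\<tau> n)) \<le> D (\<tau> (Suc n)) (Y (\<tau> (Suc n)))"
      using slope_mono[OF \<tau>(3)[of n]] XY[OF \<tau>(1,2)[of n]] XY[OF \<tau>(1,2)[of "Suc n"]]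
      unfolding D_def M_def by blast
    then show ?case
      using Suc XY[OF \<tau>(1,2)[of "Suc n"]] by (simp add: algebra_simps)
  qed simp
  have bound: "\<bar>D t z\<bar> \<le> (norm f + d * norm h) * norm h" if "0 < t" "t < d" for t z
  proof -
    have "\<bar>D t z\<bar> \<le> cmod (apply_bcontfun (f + t *\<^sub>R h) z) * cmod (apply_bcontfun h z)"
      unfolding D_def using abs_Re_le_cmod by (metis complex_mod_cnj norm_mult)
    also have "\<dots> \<le> norm (f + t *\<^sub>R h) * norm h"
      by (intro mult_mono norm_bounded) auto
    also have "norm (f + t *\<^sub>R h) \<le> norm f + t * norm h"
      using norm_triangle_ineq[of f "t *\<^sub>R h"] that by simp
    also have "\<dots> \<le> norm f + d * norm h"
      using that by (simp add: mult_right_mono)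
    finally show ?thesis
      by (simp add: mult_right_mono)
  qed
  \<comment> \<open>The factor 2 arises because the first and the last slope may have opposite
    signs.\<close>
  obtain n where "2 * ((norm f + d * norm h) * norm h) < real n * e"
    using reals_Archimedean3[OF \<open>0 < e\<close>] by blast
  then show False
    using lower[of n] bound[OF \<tau>(1,2)[of 0], of "X (\<tau> 0)"] bound[OF \<tau>(1,2)[of n], of "X (\<tau> n)"]
    by linarith
qed

lemma two_slopes_complement_dense:
  fixes A :: "('a::topological_space \<Rightarrow>\<^sub>C complex) set"
  assumes "closed_csubspace A" "h \<in> A" "0 < e"
  shows "(top_of_set A) closure_of (A - two_slopes h e) = A"
  unfolding dense_in_iff[OF Diff_subset]
proof (intro ballI allI impI)
  fix f and r :: real assume f: "f \<in> A" and r: "0 < r"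
  \<comment> \<open>The summand 1 covers the case \<open>h = 0\<close>.\<close>
  have "0 < r / (norm h + 1)"
    using r by (simp add: add_nonneg_pos)
  then obtain t where t: "0 < t" "t < r / (norm h + 1)" "f + t *\<^sub>R h \<notin> two_slopes h e"
    using line_leaves_two_slopes[OF \<open>0 < e\<close>] by blast
  have "t * (norm h + 1) < r"
    using t(2) by (simp add: pos_less_divide_eq add_nonneg_pos)
  then have "dist (f + t *\<^sub>R h) f < r"
    using t(1) by (simp add: dist_norm algebra_simps)
  moreover have "f + t *\<^sub>R h \<in> A"
    using assms f by (simp add: csubspace_add csubspace_scaleR)
  ultimately show "\<exists>g\<in>A - two_slopes h e. dist g f < r"
    using t(3) by blast
qed

text \<open>All slopes of the zero function vanish, so it lies in no \<open>two_slopes h e\<close>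
  with \<open>0 < e\<close> and has to be removed separately.\<close>

lemma nonzero_dense:
  fixes A :: "('a::topological_space \<Rightarrow>\<^sub>C complex) set"
  assumes "closed_csubspace A" "A \<noteq> {0}"
  shows "(top_of_set A) closure_of (A - {0}) = A"
  unfolding dense_in_iff[OF Diff_subset]
proof (intro ballI allI impI)
  fix f and r :: real assume f: "f \<in> A" and r: "0 < r"
  obtain k where k: "k \<in> A" "k \<noteq> 0"
    using assms csubspace_0[OF assms(1)] by blast
  show "\<exists>g\<in>A - {0}. dist g f < r"
  proof (cases "f = 0")
    case True
    let ?g = "(r / 2 / norm k) *\<^sub>R k"
    have "?g \<in> A - {0}" "dist ?g f < r"
      using k r True csubspace_scaleR[OF assms(1) k(1)] by (auto simp: dist_norm)
    then show ?thesis
      by blast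
  qed (use f r in \<open>auto intro: bexI[of _ f]\<close>)
qed

section \<open>Peak functions\<close>

lemma peak_functions_eq:
  fixes A :: "('a::topological_space \<Rightarrow>\<^sub>C complex) set"
  assumes K: "compact (UNIV :: 'a set)"
    and A: "closed_csubspace A" and sep: "separating A"
    and D: "D \<subseteq> A" "(top_of_set A) closure_of D = A"
  shows "peak_functions A = (A - {0}) \<inter> (\<Inter>h\<in>D. \<Inter>n. A - two_slopes h (1 / real (Suc n)))"
proof (intro equalityI subsetI)
  fix f assume "f \<in> peak_functions A"
  then show "f \<in> (A - {0}) \<inter> (\<Inter>h\<in>D. \<Inter>n. A - two_slopes h (1 / real (Suc n)))"
    by (force simp: peak_functions_def two_slopes_def)
next
  fix f assume "f \<in> (A - {0}) \<inter> (\<Inter>h\<in>D. \<Inter>n. A - two_slopes h (1 / real (Suc n)))"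
  then have f: "f \<in> A" "f \<noteq> 0" and nts: "\<And>h n. h \<in> D \<Longrightarrow> f \<notin> two_slopes h (1 / real (Suc n))"
    by blast+
  define L where "L h z = Re (cnj (apply_bcontfun f z) * apply_bcontfun h z)" for h z
  \<comment> \<open>The roles of \<open>x\<close> and \<open>y\<close> are interchangeable, so this
    inequality amounts to equality of the slopes.\<close>
  have le_D: "L h x \<le> L h y" if "h \<in> D" "cmod (apply_bcontfun f x) = norm f"
    "cmod (apply_bcontfun f y) = norm f" for h x y
  proof (rule ccontr)
    assume "\<not> L h x \<le> L h y"
    then obtain n where "1 / real (Suc n) < L h x - L h y"
      using nat_approx_posE[of "L h x - L h y"] by auto
    then have "f \<in> two_slopes h (1 / real (Suc n))"
      using that unfolding two_slopes_def L_def by fastforce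
    then show False
      using nts \<open>h \<in> D\<close> by blast
  qed
  \<comment> \<open>The inequality is a closed condition on \<open>h\<close>, so it passes from
    \<open>D\<close> to its closure.\<close>
  have le_A: "L h x \<le> L h y" if h: "h \<in> A" and xy: "cmod (apply_bcontfun f x) = norm f"
    "cmod (apply_bcontfun f y) = norm f" for h x y
  proof -
    have "closed {h. L h x \<le> L h y}"
      unfolding L_def
      by (intro closed_Collect_le continuous_intros continuous_on_apply_bcontfun_pair)
    moreover have "D \<subseteq> {h. L h x \<le> L h y}"
      using le_D xy by blast
    ultimately have "closure D \<subseteq> {h. L h x \<le> L h y}"
      by (rule closure_minimal[rotated])
    moreover have "h \<in> closure D"
      using h D by (auto simp: dense_in_iff closure_approachable)
    ultimately show ?thesis
      by blast
  qed
  have eq: "x = y" if xy: "cmod (apply_bcontfun f x) = norm f" "cmod (apply_bcontfun f y) = norm f" for x y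
  proof (rule ccontr)
    assume "x \<noteq> y"
    let ?\<alpha> = "cnj (apply_bcontfun f x) / norm f" and ?\<beta> = "cnj (apply_bcontfun f y) / norm f"
    have "cmod ?\<alpha> = 1" "cmod ?\<beta> = 1"
      using f xy by (simp_all add: norm_divide)
    then obtain h where h: "h \<in> A" "?\<alpha> * apply_bcontfun h x \<noteq> ?\<beta> * apply_bcontfun h y"
      using sep \<open>x \<noteq> y\<close> unfolding separating_def by blast
    \<comment> \<open>Since Re (i z) = - Im z, the slopes along \<open>cscale \<i> h\<close> supply
      the imaginary parts.\<close>
    have "L h x = L h y" "L (cscale \<i> h) x = L (cscale \<i> h) y"
      using le_A xy h(1) csubspace_cscale[OF A h(1)] by (meson order_antisym)+
    then have "cnj (apply_bcontfun f x) * apply_bcontfun h x = cnj (apply_bcontfun f y) * apply_bcontfun h y"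
      by (simp add: L_def complex_eq_iff)
    then show False
      using h(2) by simp
  qed
  obtain x where "cmod (apply_bcontfun f x) = norm f"
    using norm_bcontfun_attained[OF K] by blast
  then show "f \<in> peak_functions A"
    using f eq unfolding peak_functions_def by blast
qed

lemma peak_functions_dense_gdelta:
  fixes A :: "('a::topological_space \<Rightarrow>\<^sub>C complex) set"
  assumes K: "compact (UNIV :: 'a set)"
    and A: "closed_csubspace A" and ne: "A \<noteq> {0}" and sep: "separating A"
    and "separable_space (top_of_set A)"
  shows "gdelta_in (top_of_set A) (peak_functions A)"
    and "(top_of_set A) closure_of (peak_functions A) = A"
proof -
  obtain D where D: "countable D" "D \<subseteq> A" "(top_of_set A) closure_of D = A"
    using assms(5) by (auto simp: separable_space_def)
  \<comment> \<open>The inserted member makes \<open>G\<close> nonempty, which keeps the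
    intersection inside \<open>A\<close>.\<close>
  define G where "G = insert (A - {0})
    ((\<lambda>(h, n). A - two_slopes h (1 / real (Suc n))) ` (D \<times> UNIV))"
  have "countable G"
    using D(1) by (auto simp: G_def)
  have eq: "peak_functions A = \<Inter>G"
    unfolding peak_functions_eq[OF K A sep D(2,3)] G_def by auto
  have opn: "openin (top_of_set A) (A - C)" if "closed C" for C
    using that openin_open_Int[of "- C" A] by (simp add: Diff_eq open_Compl)
  have G: "openin (top_of_set A) T \<and> (top_of_set A) closure_of T = topspace (top_of_set A)"
    if "T \<in> G" for T
    using that D(2) nonzero_dense[OF A ne]
    by (auto simp: G_def opn closed_two_slopes[OF K] two_slopes_complement_dense[OF A])
  show "gdelta_in (top_of_set A) (peak_functions A)"
    unfolding eq using \<open>countable G\<close> G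
    by (intro gdelta_in_Inter open_imp_gdelta_in) (auto simp: G_def)
  have "completely_metrizable_space (top_of_set A)"
    using A by (simp add: closed_csubspace_def completely_metrizable_space_closed_bcontfun)
  then show "(top_of_set A) closure_of (peak_functions A) = A"
    unfolding eq using Baire_category[of "top_of_set A" G] \<open>countable G\<close> G by simp
qed

text \<open>Off the interior of \<open>V\<close> the modulus attains its maximum by compactness.
  That maximum is below the norm, as \<open>x\<close> is not there, and the difference serves as
  \<delta>.\<close>

lemma peak_imp_strong_peak:
  fixes f :: "'a::topological_space \<Rightarrow>\<^sub>C complex"
  assumes K: "compact (UNIV :: 'a set)" and f: "f \<noteq> 0"
    and x: "cmod (apply_bcontfun f x) = norm f"
    and unique: "\<And>y. cmod (apply_bcontfun f y) = norm f \<Longrightarrow> y = x"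
  shows "strong_peak_at f x"
  unfolding strong_peak_at_def
proof (intro conjI allI impI)
  fix V assume xV: "x \<in> interior V"
  show "\<exists>\<delta>>0. \<forall>y. y \<notin> V \<longrightarrow> cmod (apply_bcontfun f y) \<le> norm f - \<delta>"
  proof (cases "- interior V = {}")
    case True
    then show ?thesis
      using interior_subset[of V] by (intro exI[of _ 1]) auto
  next
    case False
    have "compact (- interior V)"
      using closed_Int_compact[OF _ K, of "- interior V"] by (simp add: closed_Compl)
    then obtain y where y: "y \<notin> interior V"
      "\<forall>z \<in> - interior V. cmod (apply_bcontfun f z) \<le> cmod (apply_bcontfun f y)"
      using continuous_attains_sup[OF _ False, of "\<lambda>x. cmod (apply_bcontfun f x)"]
      by (auto intro: continuous_intros)
    have "cmod (apply_bcontfun f y) < norm f"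
      using unique[of y] y(1) xV norm_bounded[of f y] by fastforce
    moreover have "cmod (apply_bcontfun f z) \<le> cmod (apply_bcontfun f y)" if "z \<notin> V" for z
      using y(2) that interior_subset[of V] by blast
    ultimately show ?thesis
      by (intro exI[of _ "norm f - cmod (apply_bcontfun f y)"]) auto
  qed
qed (use f x unique in blast)+

section \<open>Norming sets\<close>

lemma bdd_above_cmod_bcontfun:
  fixes f :: "'a::topological_space \<Rightarrow>\<^sub>C complex"
  shows "bdd_above ((\<lambda>x. cmod (apply_bcontfun f x)) ` F)"
  by (auto intro!: bdd_aboveI2[where M = "norm f"] norm_bounded)

lemma normingI:
  fixes A :: "('a::topological_space \<Rightarrow>\<^sub>C complex) set"
  assumes "F \<noteq> {}" "\<And>f e. f \<in> A \<Longrightarrow> 0 < e \<Longrightarrow> \<exists>x\<in>F. norm f \<le> cmod (apply_bcontfun f x) + e"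
  shows "norming A F"
  unfolding norming_def
proof
  fix f assume f: "f \<in> A"
  let ?S = "SUP x\<in>F. cmod (apply_bcontfun f x)"
  have "?S \<le> norm f"
    using assms(1) by (intro cSUP_least norm_bounded)
  moreover have "norm f \<le> ?S + e" if "0 < e" for e
  proof -
    obtain x where "x \<in> F" "norm f \<le> cmod (apply_bcontfun f x) + e"
      using assms(2)[OF f \<open>0 < e\<close>] by blast
    then show ?thesis
      using cSUP_upper[OF _ bdd_above_cmod_bcontfun, of x F f] by linarith
  qed
  then have "norm f \<le> ?S"
    by (rule field_le_epsilon)
  ultimately show "norm f = ?S"
    by simp
qed

text \<open>A peak function \<open>g\<close> near \<open>f\<close> peaks at a point of
  \<open>F\<close>, and there the modulus of \<open>f\<close> falls short of \<open>norm f\<close>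
  by at most twice the distance. Allowing supersets \<open>F\<close> covers the closure as
  well.\<close>

lemma norming_strong_peak_points:
  fixes A :: "('a::topological_space \<Rightarrow>\<^sub>C complex) set"
  assumes K: "compact (UNIV :: 'a set)" and A: "closed_csubspace A"
    and dense: "(top_of_set A) closure_of (peak_functions A) = A"
    and F: "strong_peak_points A \<subseteq> F"
  shows "norming A F"
proof -
  have approx: "\<exists>x\<in>F. norm f \<le> cmod (apply_bcontfun f x) + e" if f: "f \<in> A" and e: "0 < e" for f e
  proof -
    have "peak_functions A \<subseteq> A"
      by (auto simp: peak_functions_def)
    then obtain g where g: "g \<in> peak_functions A" "dist g f < e / 2"
      using dense f half_gt_zero[OF e] dense_in_iff[of "peak_functions A" A] by blast
    then obtain x where x: "cmod (apply_bcontfun g x) = norm g" "strong_peak_at g x"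
      using peak_imp_strong_peak[OF K] unfolding peak_functions_def by blast
    then have "x \<in> F"
      using g(1) F unfolding strong_peak_points_def peak_functions_def by blast
    moreover have "norm f \<le> norm g + dist g f"
      using norm_triangle_sub[of f g] by (simp add: dist_norm norm_minus_commute)
    moreover have "norm g \<le> cmod (apply_bcontfun f x) + dist g f"
      using norm_triangle_sub[of "apply_bcontfun g x" "apply_bcontfun f x"] dist_bounded[of g x f] x(1)
      by (simp add: dist_norm)
    ultimately show ?thesis
      using g(2) by (intro bexI[of _ x]) auto
  qed
  moreover have "F \<noteq> {}"
    using approx[OF csubspace_0[OF A], of 1] by auto
  ultimately show ?thesis
    by (rule normingI[rotated])
qed

lemma strong_peak_points_subset_norming:
  fixes A :: "('a::topological_space \<Rightarrow>\<^sub>C complex) set"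
  assumes A: "closed_csubspace A" and G: "closed G" "norming A G"
  shows "strong_peak_points A \<subseteq> G"
proof
  fix x assume "x \<in> strong_peak_points A"
  then obtain f where f: "f \<in> A" "strong_peak_at f x"
    by (auto simp: strong_peak_points_def)
  have "G \<noteq> {}"
  proof
    assume "G = {}"
    \<comment> \<open>Both norms equal the same unspecified supremum over the empty set.\<close>
    then have "norm f = norm (0 :: 'a \<Rightarrow>\<^sub>C complex)"
      using G(2) f(1) csubspace_0[OF A] unfolding norming_def by (metis image_empty)
    then show False
      using f(2) by (simp add: strong_peak_at_def)
  qed
  show "x \<in> G"
  proof (rule ccontr)
    assume "x \<notin> G"
    \<comment> \<open>The complement of \<open>G\<close> is a neighborhood of \<open>x\<close>, so
      the strong peak keeps the modulus on \<open>G\<close> uniformly below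
      \<open>norm f\<close>.\<close>
    then have "x \<in> interior (- G)"
      using G(1) by (simp add: interior_open open_Compl)
    then obtain d where d: "0 < d" "\<And>y. y \<in> G \<Longrightarrow> cmod (apply_bcontfun f y) \<le> norm f - d"
      using f(2) unfolding strong_peak_at_def by (metis ComplD)
    have "(SUP y\<in>G. cmod (apply_bcontfun f y)) \<le> norm f - d"
      using \<open>G \<noteq> {}\<close> d(2) by (rule cSUP_least)
    then show False
      using G(2) f(1) d(1) by (simp add: norming_def)
  qed
qed

theorem theorem3p1:
  fixes A :: "('a::t2_space \<Rightarrow>\<^sub>C complex) set"
  assumes "compact (UNIV :: 'a set)"
    and "closed_csubspace A"
    and "A \<noteq> {0}"
    and "separating A"
    and "separable_space (top_of_set A)"
  shows "gdelta_in (top_of_set A) (peak_functions A)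
    \<and> (top_of_set A) closure_of (peak_functions A) = A
    \<and> norming A (strong_peak_points A)
    \<and> smallest_closed_norming A (closure (strong_peak_points A))
    \<and> shilov_boundary A = closure (strong_peak_points A)"
proof -
  note peak = peak_functions_dense_gdelta[OF assms]
  note norming = norming_strong_peak_points[OF assms(1,2) peak(2)]
  have smallest: "smallest_closed_norming A (closure (strong_peak_points A))"
    unfolding smallest_closed_norming_def
    using norming[OF closure_subset] strong_peak_points_subset_norming[OF assms(2)]
    by (auto intro: closure_minimal[THEN subsetD])
  then have "shilov_boundary A = closure (strong_peak_points A)"
    unfolding shilov_boundary_def
    by (rule the_equality) (use smallest in \<open>auto simp: smallest_closed_norming_def\<close>)
  with peak norming[OF order_refl] smallest show ?thesis
    by simp
qed

end
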